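(* Let $K\ge1$ be an integer with $K\equiv \pm1\pmod 6$, and let $p_1^{a_1}\cdots p_r^{a_r}$ be the prime factorization of $K^2+4$. If $m=24\cdot p_1^{j_1}\cdots p_r^{j_r}$ for some integers $j_1,\dots,j_r\ge 0$, then $\pi_K(m)=m$.
   Context: The $K$-Fibonacci sequence is $F_{K,0}=0$, $F_{K,1}=1$, $F_{K,n}=K F_{K,n-1}+F_{K,n-2}$; for an integer $m>1$, $\pi_K(m)$ is the length of its shortest period modulo $m$. *)

theory Defs
  imports "HOL-Number_Theory.Number_Theory"
begin

fun kfib :: "int \<Rightarrow> nat \<Rightarrow> int" where
  "kfib K 0 = 0"
| "kfib K (Suc 0) = 1"
| "kfib K (Suc (Suc n)) = K * kfib K (Suc n) + kfib K n"

text \<open>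
  The recurrence is invertible modulo \<open>m\<close>, so the sequence is purely periodic modulo every
  \<open>m > 1\<close>; a period is required to hold from index \<open>0\<close> on, and for such \<open>m\<close> the minimum exists.
\<close>

definition kperiod :: "int \<Rightarrow> int \<Rightarrow> nat" where
  "kperiod K m = (LEAST t. 0 < t \<and> (\<forall>n. [kfib K (n + t) = kfib K n] (mod m)))"

end

theory Submission
  imports Defs
begin

text \<open>
  Put \<open>D = K\<^sup>2 + 4\<close>, which is coprime to 6. Binet's formula gives
  \<open>2\<^sup>n F\<^sub>n = 2 \<Sum> binom(n, i) K\<^sup>n\<^sup>-\<^sup>i D\<^sup>(\<^sup>i\<^sup>-\<^sup>1\<^sup>)\<^sup>/\<^sup>2\<close>, summed over odd \<open>i\<close>. For a prime \<open>p\<close> dividing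
  \<open>D\<close> (so \<open>p \<ge> 5\<close>) every term with \<open>i \<ge> 3\<close> has larger \<open>p\<close>-adic valuation than the term
  \<open>n K\<^sup>n\<^sup>-\<^sup>1\<close>, hence \<open>F\<^sub>n\<close> and \<open>n\<close> have the same \<open>p\<close>-adic valuation. So a product \<open>P\<close> of powers
  of such primes divides \<open>F\<^sub>n\<close> iff it divides \<open>n\<close>. Modulo 24 the period is 24 by inspection of
  the eight residues of \<open>K\<close>. The two parts combine because \<open>P\<close> is coprime to 24; the congruence
  \<open>F\<^sub>n\<^sub>+\<^sub>1 \<equiv> 1\<close> modulo \<open>P\<close> at \<open>n = 24 P\<close> comes from Cassini's identity and index doubling.
\<close>

section \<open>Basic identities and the criterion for a period\<close>

lemma kfib_add:
  "kfib K (Suc (m + n)) = kfib K (Suc m) * kfib K (Suc n) + kfib K m * kfib K n"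
proof (induction m arbitrary: n rule: less_induct)
  case (less m)
  show ?case
  proof (cases m)
    case (Suc m')
    have "kfib K (Suc (m + n)) = kfib K (Suc (m' + Suc n))"
      using Suc by simp
    also have "\<dots> = kfib K (Suc m') * kfib K (Suc (Suc n)) + kfib K m' * kfib K (Suc n)"
      using less Suc by blast
    also have "\<dots> = kfib K (Suc m) * kfib K (Suc n) + kfib K m * kfib K n"
      using Suc by (simp add: algebra_simps)
    finally show ?thesis .
  qed simp
qed

text \<open>The quadratic form \<open>y\<^sup>2 - K * x * y - x\<^sup>2\<close> changes sign under
  one step \<open>(x, y) \<mapsto> (y, K * y + x)\<close> of the recurrence, and its value at the
  initial state \<open>(0, 1)\<close> is 1.\<close>

lemma kfib_cassini:
  "(kfib K (Suc n))\<^sup>2 - K * kfib K n * kfib K (Suc n) - (kfib K n)\<^sup>2 = (- 1) ^ n"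
proof (induction n)
  case (Suc n)
  have "(kfib K (Suc (Suc n)))\<^sup>2 - K * kfib K (Suc n) * kfib K (Suc (Suc n)) - (kfib K (Suc n))\<^sup>2
      = - ((kfib K (Suc n))\<^sup>2 - K * kfib K n * kfib K (Suc n) - (kfib K n)\<^sup>2)"
    by (simp add: algebra_simps power2_eq_square)
  then show ?case using Suc by simp
qed simp

lemma kfib_cong_base:
  assumes "[K = K'] (mod m)"
  shows "[kfib K n = kfib K' n] (mod m)"
proof (induction n rule: less_induct)
  case (less n)
  consider "n = 0" | "n = 1" | k where "n = Suc (Suc k)"
    by (metis One_nat_def not0_implies_Suc)
  then show ?case
  proof cases
    case 3
    then show ?thesis using less assms by (auto intro!: cong_add cong_mult)
  qed auto
qed

text \<open>A second-order recurrence is determined by two consecutive values, so returning to the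
  initial state \<open>(0, 1)\<close> is enough. The addition formula makes this explicit: later
  values are linear in the state at \<open>t\<close>.\<close>

lemma kfib_period_iff:
  "(\<forall>n. [kfib K (n + t) = kfib K n] (mod m)) \<longleftrightarrow>
     [kfib K t = 0] (mod m) \<and> [kfib K (Suc t) = 1] (mod m)"
proof safe
  assume per: "\<forall>n. [kfib K (n + t) = kfib K n] (mod m)"
  show "[kfib K t = 0] (mod m)" "[kfib K (Suc t) = 1] (mod m)"
    using per[rule_format, of 0] per[rule_format, of 1] by simp_all
next
  fix n
  assume t: "[kfib K t = 0] (mod m)" "[kfib K (Suc t) = 1] (mod m)"
  show "[kfib K (n + t) = kfib K n] (mod m)"
  proof (cases n)
    case (Suc k)
    have "[kfib K (Suc k) * kfib K (Suc t) + kfib K k * kfib K t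
        = kfib K (Suc k) * 1 + kfib K k * 0] (mod m)"
      by (intro cong_add cong_mult t cong_refl)
    then show ?thesis using Suc by (simp add: kfib_add)
  qed (use t in simp)
qed

section \<open>Binet's formula and p-adic valuations\<close>

lemma kfib_binet:
  fixes K :: int
  defines "s \<equiv> sqrt (of_int (K\<^sup>2 + 4))"
  shows "2 ^ n * s * of_int (kfib K n) = (of_int K + s) ^ n - (of_int K - s) ^ n"
proof (induction n rule: less_induct)
  case (less n)
  consider "n = 0" | "n = 1" | k where "n = Suc (Suc k)"
    by (metis One_nat_def not0_implies_Suc)
  then show ?case
  proof cases
    case 3
    have s2: "s * s = of_int K * of_int K + 4"
      by (simp add: s_def power2_eq_square)
    \<comment> \<open>The numbers \<open>K + s\<close> and \<open>K - s\<close> are twice the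
      characteristic roots, hence the doubled recurrence \<open>x\<^sup>2 = 2 * K * x + 4\<close>.
      The spare factor \<open>y\<close> matches the shape of unfolded powers.\<close>
    have root: "x * (x * y) = 2 * of_int K * (x * y) + 4 * y"
      if "x = of_int K + s \<or> x = of_int K - s" for x y :: real
    proof -
      have "x * x = 2 * of_int K * x + 4"
        using that s2 by (elim disjE; simp; simp add: algebra_simps)
      then have "x * x * y = (2 * of_int K * x + 4) * y" by simp
      then show ?thesis by (simp add: algebra_simps)
    qed
    have "2 ^ n * s * of_int (kfib K n)
        = 2 * of_int K * (2 ^ Suc k * s * of_int (kfib K (Suc k))) + 4 * (2 ^ k * s * of_int (kfib K k))"
      using 3 by (simp add: algebra_simps)
    also have "\<dots> = 2 * of_int K * ((of_int K + s) ^ Suc k - (of_int K - s) ^ Suc k)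
        + 4 * ((of_int K + s) ^ k - (of_int K - s) ^ k)"
      using less[of k] less[of "Suc k"] 3 by simp
    also have "\<dots> = (of_int K + s) ^ n - (of_int K - s) ^ n"
      unfolding 3 power_Suc by (subst (1 2) root) (auto simp: algebra_simps)
    finally show ?thesis .
  qed auto
qed

text \<open>Expanding both powers in Binet's formula, the even powers of \<open>s\<close> cancel and
  the odd ones double. Cancelling one factor \<open>s\<close> leaves only powers of
  \<open>s\<^sup>2 = K\<^sup>2 + 4\<close>, so the identity descends to the integers.\<close>

lemma kfib_binomial_sum:
  "2 ^ n * kfib K n
     = 2 * (\<Sum>i | i \<le> n \<and> odd i. int (n choose i) * K ^ (n - i) * (K\<^sup>2 + 4) ^ (i div 2))"
proof -
  define s where "s = sqrt (of_int (K\<^sup>2 + 4))"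
  have D: "of_int (K\<^sup>2 + 4) > (0::real)"
    by (metis add_nonneg_pos of_int_0_less_iff zero_le_power2 zero_less_numeral)
  then have s0: "s \<noteq> 0" and s2: "s\<^sup>2 = of_int (K\<^sup>2 + 4)"
    by (auto simp: s_def)
  have odd_power: "s ^ i = s * of_int (K\<^sup>2 + 4) ^ (i div 2)" if "odd i" for i
    using that s2 by (metis odd_two_times_div_two_succ power_mult power_Suc Suc_eq_plus1)
  have "s * (2 ^ n * of_int (kfib K n)) = (s + of_int K) ^ n - (- s + of_int K) ^ n"
    using kfib_binet[of n K] by (simp add: s_def algebra_simps)
  also have "\<dots> = (\<Sum>i\<le>n. of_nat (n choose i) * s ^ i * of_int K ^ (n - i)
      - of_nat (n choose i) * (- s) ^ i * of_int K ^ (n - i))"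
    by (simp only: binomial_ring sum_subtractf)
  also have "\<dots> = (\<Sum>i\<le>n. if odd i
      then s * (2 * (of_nat (n choose i) * of_int K ^ (n - i) * of_int (K\<^sup>2 + 4) ^ (i div 2))) else 0)"
    by (intro sum.cong) (auto simp del: of_int_add simp: odd_power)
  also have "\<dots> = s * (2 * (\<Sum>i | i \<le> n \<and> odd i.
      of_nat (n choose i) * of_int K ^ (n - i) * of_int (K\<^sup>2 + 4) ^ (i div 2)))"
    by (simp add: sum.If_cases sum_distrib_left Collect_conj_eq atMost_def del: of_int_add)
  finally have "2 ^ n * of_int (kfib K n) = 2 * (\<Sum>i | i \<le> n \<and> odd i.
      of_nat (n choose i) * of_int K ^ (n - i) * (of_int (K\<^sup>2 + 4) :: real) ^ (i div 2))"
    using s0 by simp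
  then have "(of_int (2 ^ n * kfib K n) :: real) = of_int (2 * (\<Sum>i | i \<le> n \<and> odd i.
      int (n choose i) * K ^ (n - i) * (K\<^sup>2 + 4) ^ (i div 2)))"
    by simp
  then show ?thesis by (simp only: of_int_eq_iff)
qed

text \<open>Absorption gives \<open>(2 * k + 1) * (n choose (2 * k + 1)) = n * ((n - 1) choose (2 *
  k))\<close> for positive \<open>n\<close>. The power of \<open>p\<close> lost to
  \<open>2 * k + 1\<close> is smaller than the one supplied by \<open>D ^ k\<close>.\<close>

lemma prime_power_dvd_binomial_times_power:
  fixes p D :: int
  assumes p: "prime p" "p \<ge> 5" "p dvd D" and n: "p ^ v dvd int n" and k: "k > 0"
  shows "p ^ Suc v dvd int (n choose Suc (2 * k)) * D ^ k"
proof (cases n)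
  case (Suc n')
  define s where "s = multiplicity p (int (Suc (2 * k)))"
  obtain u where u: "int (Suc (2 * k)) = p ^ s * u"
    unfolding s_def using multiplicity_dvd by (metis dvd_def)
  have "s < k"
  proof (rule ccontr)
    assume "\<not> s < k"
    \<comment> \<open>Here \<open>p \<ge> 5\<close> matters: for \<open>p = 3\<close> and
      \<open>k = 1\<close> the multiplicity of \<open>p\<close> in \<open>2 * k + 1\<close> equals
      \<open>k\<close>.\<close>
    have "int (Suc (2 * k)) < 5 ^ k"
      using k by (induction k rule: nat_induct_non_zero) auto
    also have "\<dots> \<le> p ^ k" using p by (intro power_mono) auto
    also have "\<dots> \<le> p ^ s" using p \<open>\<not> s < k\<close> by (intro power_increasing) auto
    also have "\<dots> \<le> int (Suc (2 * k))"
      using multiplicity_dvd[of p "int (Suc (2 * k))"] unfolding s_def by (intro zdvd_imp_le) auto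
    finally show False by simp
  qed
  have "int (Suc (2 * k)) * int (n choose Suc (2 * k)) = int n * int (n' choose (2 * k))"
    unfolding Suc using binomial_absorption[of "2 * k" "Suc n'"]
    by (simp only: of_nat_mult[symmetric] diff_Suc_1)
  then have eq: "p ^ s * (u * (int (n choose Suc (2 * k)) * D ^ k))
      = int n * D ^ k * int (n' choose (2 * k))"
    unfolding u by (simp add: algebra_simps)
  have "p ^ s * p ^ Suc v dvd p ^ v * p ^ k"
    using \<open>s < k\<close> by (simp only: power_add[symmetric]) (intro le_imp_power_dvd, simp)
  also have "\<dots> dvd int n * D ^ k * int (n' choose (2 * k))"
    using n p by (intro dvd_mult2 mult_dvd_mono dvd_power_same)
  finally have "p ^ Suc v dvd u * (int (n choose Suc (2 * k)) * D ^ k)"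
    unfolding eq[symmetric] using p by (simp add: dvd_times_left_cancel_iff)
  moreover have "\<not> p dvd u"
  proof
    assume "p dvd u"
    then have "p ^ Suc s dvd int (Suc (2 * k))" unfolding u by (simp add: mult.commute mult_dvd_mono)
    moreover have "\<not> p ^ Suc s dvd int (Suc (2 * k))"
      unfolding s_def using p by (subst power_dvd_iff_le_multiplicity) (auto dest: not_prime_unit)
    ultimately show False by blast
  qed
  then have "coprime (p ^ Suc v) u"
    using p by (simp add: prime_imp_coprime)
  ultimately show ?thesis by (simp only: coprime_dvd_mult_right_iff)
qed simp

lemma prime_power_dvd_kfib_iff:
  fixes p K :: int
  assumes p: "prime p" "p \<ge> 5" "p dvd K\<^sup>2 + 4"
  shows "p ^ j dvd kfib K n \<longleftrightarrow> p ^ j dvd int n"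
proof (cases "n = 0")
  case False
  define v where "v = multiplicity p (int n)"
  define S where "S = (\<Sum>i | i \<le> n \<and> odd i. int (n choose i) * K ^ (n - i) * (K\<^sup>2 + 4) ^ (i div 2))"
  define R where "R = (\<Sum>i | i \<le> n \<and> odd i \<and> i \<noteq> 1. int (n choose i) * K ^ (n - i) * (K\<^sup>2 + 4) ^ (i div 2))"
  have not_dvd: "\<not> p dvd 2" "\<not> p dvd K"
  proof -
    show p2: "\<not> p dvd 2" using p by (auto dest: zdvd_imp_le)
    show "\<not> p dvd K"
    proof
      assume "p dvd K"
      then have "p dvd K\<^sup>2" by (simp add: power2_eq_square)
      then have "p dvd 2 * 2" using p(3) by (simp add: dvd_add_right_iff)
      then show False using p p2 prime_dvd_mult_iff by blast
    qed
  qed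
  \<comment> \<open>The term \<open>i = 1\<close> is split off because it alone fixes the valuation
    of \<open>S\<close>.\<close>
  have "{i. i \<le> n \<and> odd i} = insert 1 {i. i \<le> n \<and> odd i \<and> i \<noteq> 1}"
    using False by auto
  then have S: "S = int n * K ^ (n - 1) + R"
    unfolding S_def R_def by simp
  have v: "p ^ v dvd int n" "\<not> p ^ Suc v dvd int n"
    using p False by (auto simp: v_def multiplicity_dvd power_dvd_iff_le_multiplicity not_less_eq_eq
        simp del: power_Suc)
  have R: "p ^ Suc v dvd R"
    unfolding R_def
  proof (rule dvd_sum, clarsimp simp del: power_Suc)
    fix i assume i: "i \<le> n" "odd i" "i \<noteq> Suc 0"
    then obtain k where "i = Suc (2 * k)" "k > 0"
      by (metis oddE Suc_eq_plus1 mult_0_right neq0_conv)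
    then have "p ^ Suc v dvd int (n choose i) * (K\<^sup>2 + 4) ^ (i div 2) * K ^ (n - i)"
      using prime_power_dvd_binomial_times_power[OF p v(1), of k]
      by (intro dvd_mult2[of _ "_ * _"]) (simp del: power_Suc)
    then show "p ^ Suc v dvd int (n choose i) * K ^ (n - i) * (K\<^sup>2 + 4) ^ (i div 2)"
      by (simp only: ac_simps)
  qed
  have cop: "coprime (p ^ j) (K ^ (n - 1))" "coprime (p ^ j) (2 ^ l)" for j l
    using prime_imp_coprime[OF p(1) not_dvd(1)] prime_imp_coprime[OF p(1) not_dvd(2)]
    by (simp_all only: coprime_power_left_iff coprime_power_right_iff simp_thms)
  have S_lo: "p ^ v dvd S"
    unfolding S using v R by (meson dvd_add dvd_mult2 power_le_dvd le_SucI order_refl)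
  have S_hi: "\<not> p ^ Suc v dvd S"
    unfolding S using v R cop(1)[of "Suc v"]
    by (simp add: dvd_add_left_iff coprime_dvd_mult_left_iff del: power_Suc)
  have dvd_S: "p ^ j dvd kfib K n \<longleftrightarrow> p ^ j dvd S" for j
  proof -
    have "p ^ j dvd kfib K n \<longleftrightarrow> p ^ j dvd 2 ^ n * kfib K n"
      using cop(2)[of j n] by (simp add: coprime_dvd_mult_right_iff)
    also have "\<dots> \<longleftrightarrow> p ^ j dvd S"
      using kfib_binomial_sum[of n K] cop(2)[of j 1] S_def by (simp add: coprime_dvd_mult_right_iff)
    finally show ?thesis .
  qed
  \<comment> \<open>Applied to both \<open>int n\<close> and \<open>S\<close>, whose valuation is
    exactly \<open>v\<close>.\<close>
  have "p ^ j dvd x \<longleftrightarrow> j \<le> v" if "p ^ v dvd x" "\<not> p ^ Suc v dvd x" for x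
    using that by (meson not_less_eq_eq power_le_dvd)
  then show ?thesis using v S_lo S_hi dvd_S by simp
qed simp

section \<open>The period modulo 24\<close>

text \<open>The state \<open>(F\<^sub>n, F\<^sub>n\<^sub>+\<^sub>1)\<close> modulo \<open>m\<close>, in a form that evaluates in linear time.\<close>

fun kfib_mod_states :: "int \<Rightarrow> int \<Rightarrow> int \<Rightarrow> int \<Rightarrow> nat \<Rightarrow> (int \<times> int) list" where
  "kfib_mod_states m K a b 0 = []"
| "kfib_mod_states m K a b (Suc n) = (a, b) # kfib_mod_states m K b ((K * b + a) mod m) n"

lemma length_kfib_mod_states: "length (kfib_mod_states m K a b n) = n"
  by (induction n arbitrary: a b) auto

lemma nth_kfib_mod_states:
  assumes "i < n" "a = kfib K l mod m" "b = kfib K (Suc l) mod m"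
  shows "kfib_mod_states m K a b n ! i = (kfib K (l + i) mod m, kfib K (Suc (l + i)) mod m)"
  using assms
proof (induction n arbitrary: a b l i)
  case (Suc n)
  have "(K * b + a) mod m = kfib K (Suc (Suc l)) mod m"
    unfolding Suc.prems kfib.simps by (intro mod_add_cong mod_mult_cong) auto
  then show ?case
    using Suc.IH[of "i - 1" b "Suc l"] Suc.prems by (cases i) auto
qed simp

lemma kfib_mod_24:
  assumes "[K = 1] (mod 6) \<or> [K = -1] (mod 6)"
  shows "[kfib K 24 = 0] (mod 24)" "[kfib K 25 = 1] (mod 24)"
    and "0 < r \<Longrightarrow> r < 24 \<Longrightarrow> \<not> ([kfib K r = 0] (mod 24) \<and> [kfib K (Suc r) = 1] (mod 24))"
proof -
  define k where "k = K mod 24"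
  define xs where "xs = kfib_mod_states 24 k 0 1 25"
  have nth: "xs ! i = (kfib K i mod 24, kfib K (Suc i) mod 24)" if "i < 25" for i
    using nth_kfib_mod_states[OF that, of 0 k 0 24 1]
      kfib_cong_base[of k K 24 i] kfib_cong_base[of k K 24 "Suc i"]
    by (simp add: xs_def k_def cong_def)
  have "k mod 6 = K mod 6"
    by (simp add: k_def mod_mod_cancel)
  then have "k mod 6 = 1 \<or> k mod 6 = 5"
    using assms by (auto simp: cong_def)
  moreover have "k div 6 = 0 \<or> k div 6 = 1 \<or> k div 6 = 2 \<or> k div 6 = 3"
    unfolding k_def by auto
  ultimately have "k \<in> {1, 5, 7, 11, 13, 17, 19, 23}"
    using mult_div_mod_eq[of 6 k] by (elim disjE) simp_all
  \<comment> \<open>The list holds the states at indices 0 to 24. Dropping the head and keeping 23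
    entries leaves indices 1 to 23, where the initial state must not recur.\<close>
  then have xs: "xs ! 24 = (0, 1) \<and> (0, 1) \<notin> set (take 23 (tl xs))"
    unfolding xs_def
    by (elim insertE emptyE; hypsubst) (simp_all add: numeral_eq_Suc)
  show "[kfib K 24 = 0] (mod 24)" "[kfib K 25 = 1] (mod 24)"
    using nth[of 24] xs by (simp_all add: cong_def)
  assume r: "0 < r" "r < 24"
  have "length xs = 25" by (simp add: xs_def length_kfib_mod_states)
  then have "xs ! r \<in> set (take 23 (tl xs))"
    using r by (auto simp: in_set_conv_nth nth_tl intro!: exI[of _ "r - 1"])
  then show "\<not> ([kfib K r = 0] (mod 24) \<and> [kfib K (Suc r) = 1] (mod 24))"
    using nth[of r] xs r by (auto simp: cong_def)
qed

text \<open>Since 24 is a period, \<open>t\<close> may be replaced by \<open>t mod 24\<close>; a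
  nonzero remainder would be a period shorter than 24.\<close>

lemma kfib_period_24_iff:
  assumes "[K = 1] (mod 6) \<or> [K = -1] (mod 6)"
  shows "(\<forall>n. [kfib K (n + t) = kfib K n] (mod 24)) \<longleftrightarrow> 24 dvd t"
proof -
  have per24: "\<forall>n. [kfib K (n + 24) = kfib K n] (mod 24)"
    unfolding kfib_period_iff using kfib_mod_24[OF assms] by simp
  have shift: "[kfib K (n + 24 * q) = kfib K n] (mod 24)" for n q
  proof (induction q)
    case (Suc q)
    then show ?case
      using per24[rule_format, of "n + 24 * q"] by (metis add.assoc add.commute cong_trans mult_Suc_right)
  qed simp
  have "[kfib K (n + t) = kfib K (n + t mod 24)] (mod 24)" for n
    using shift[of "n + t mod 24" "t div 24"] by (simp add: add.assoc)
  then have "(\<forall>n. [kfib K (n + t) = kfib K n] (mod 24))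
      \<longleftrightarrow> (\<forall>n. [kfib K (n + t mod 24) = kfib K n] (mod 24))"
    by (meson cong_sym cong_trans)
  also have "\<dots> \<longleftrightarrow> t mod 24 = 0"
  proof
    assume "\<forall>n. [kfib K (n + t mod 24) = kfib K n] (mod 24)"
    then show "t mod 24 = 0"
      unfolding kfib_period_iff using kfib_mod_24(3)[OF assms, of "t mod 24"] by auto
  qed simp
  finally show ?thesis by (simp add: dvd_eq_mod_eq_0)
qed

section \<open>Combining the coprime moduli\<close>

lemma prod_prime_powers_dvd_iff:
  fixes A :: "int set"
  assumes "finite A" "\<And>p. p \<in> A \<Longrightarrow> prime p"
  shows "(\<Prod>p\<in>A. p ^ j p) dvd x \<longleftrightarrow> (\<forall>p\<in>A. p ^ j p dvd x)"
  using assms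
proof (induction A)
  case (insert q A)
  have "coprime (q ^ j q) (\<Prod>p\<in>A. p ^ j p)"
  proof (rule prod_coprime_right)
    fix p assume "p \<in> A"
    then have "p \<noteq> q" "prime p" "prime q" using insert by auto
    then show "coprime (q ^ j q) (p ^ j p)" by (simp add: primes_coprime)
  qed
  then show ?case
    using insert by (auto intro: divides_mult dest: dvd_mult_left dvd_mult_right)
qed simp

theorem theorem3p1:
  fixes K m :: int and j :: "int \<Rightarrow> nat"
  assumes "K \<ge> 1"
    and "[K = 1] (mod 6) \<or> [K = -1] (mod 6)"
    and "m = 24 * (\<Prod>p\<in>prime_factors (K\<^sup>2 + 4). p ^ j p)"
  shows "int (kperiod K m) = m"
proof -
  define P where "P = (\<Prod>p\<in>prime_factors (K\<^sup>2 + 4). p ^ j p)"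
  have m: "m = 24 * P" using assms(3) by (simp add: P_def)
  have not_dvd: "\<not> 2 dvd K\<^sup>2 + 4" "\<not> 3 dvd K\<^sup>2 + 4"
  proof -
    have "K mod 6 = 1 \<or> K mod 6 = 5"
      using assms(2) by (simp add: cong_def)
    then have "odd K" and "K mod 3 = 1 \<or> K mod 3 = 2"
      by presburger+
    then have "K\<^sup>2 mod 3 = 1"
      by (auto simp: power2_eq_square mod_mult_eq[of K 3 K, symmetric])
    then show "\<not> 3 dvd K\<^sup>2 + 4" by presburger
    show "\<not> 2 dvd K\<^sup>2 + 4" using \<open>odd K\<close> by simp
  qed
  have p: "prime p" "p \<ge> 5" "p dvd K\<^sup>2 + 4" if "p \<in> prime_factors (K\<^sup>2 + 4)" for p
  proof -
    show prm: "prime p" and dvd: "p dvd K\<^sup>2 + 4" using that by auto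
    have "p \<noteq> 2" "p \<noteq> 3" "p \<noteq> 4" "p \<ge> 2"
      using dvd not_dvd prm prime_ge_2_int by (auto simp: dvd_trans[of 2 4])
    then show "p \<ge> 5" by linarith
  qed
  have P_pos: "P > 0"
    unfolding P_def using p by (intro prod_pos) (simp add: prime_gt_0_int)
  have "coprime 24 p" if "p \<in> prime_factors (K\<^sup>2 + 4)" for p
  proof -
    have "coprime p 2" "coprime p 3"
      using prime_imp_coprime[OF p(1)[OF that]] p(2)[OF that] zdvd_imp_le[of p 2] zdvd_imp_le[of p 3]
      by force+
    then have "coprime p (2 ^ 3 * 3)" by (simp only: coprime_mult_right_iff coprime_power_right_iff simp_thms)
    then show ?thesis by (simp add: coprime_commute)
  qed
  then have cop: "coprime 24 P"
    unfolding P_def by (intro prod_coprime_right) simp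
  have P_dvd: "P dvd kfib K n \<longleftrightarrow> P dvd int n" for n
    unfolding P_def using p prime_power_dvd_kfib_iff by (simp add: prod_prime_powers_dvd_iff)
  let ?per = "\<lambda>m t. \<forall>n. [kfib K (n + t) = kfib K n] (mod m)"
  have per_split: "?per m t \<longleftrightarrow> ?per 24 t \<and> ?per P t" for t
    unfolding m using cop by (metis coprime_cong_mult cong_modulus_mult mult.commute)
  have "?per P (nat m)"
  proof -
    \<comment> \<open>\<open>h\<close> is half of \<open>m\<close> and even, so Cassini's sign at
      \<open>h\<close> is +1 and the square of \<open>kfib K (Suc h)\<close> is 1 modulo
      \<open>P\<close>. Doubling the index turns this square into
      \<open>kfib K (Suc (h + h))\<close>.\<close>
    define h where "h = 12 * nat P"
    have h: "[kfib K h = 0] (mod P)"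
      using P_dvd[of h] P_pos by (simp add: h_def cong_0_iff)
    have "[(kfib K (Suc h))\<^sup>2 = 1 + kfib K h * (K * kfib K (Suc h) + kfib K h)] (mod P)"
      using kfib_cassini[of K h] by (simp add: h_def algebra_simps power2_eq_square)
    moreover have "[1 + kfib K h * (K * kfib K (Suc h) + kfib K h) = 1 + 0 * (K * kfib K (Suc h) + kfib K h)] (mod P)"
      by (intro cong_add cong_mult h cong_refl)
    ultimately have sq: "[(kfib K (Suc h))\<^sup>2 = 1] (mod P)"
      using cong_trans by fastforce
    have "[(kfib K (Suc h))\<^sup>2 + kfib K h * kfib K h = 1 + 0 * 0] (mod P)"
      by (intro cong_add cong_mult h sq)
    then have "[kfib K (Suc (h + h)) = 1] (mod P)"
      by (simp add: kfib_add power2_eq_square)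
    moreover have "[kfib K (h + h) = 0] (mod P)"
      using P_dvd[of "h + h"] P_pos by (simp add: h_def cong_0_iff)
    moreover have "nat m = h + h" using P_pos by (simp add: m h_def nat_mult_distrib)
    ultimately show ?thesis unfolding kfib_period_iff by simp
  qed
  moreover have "?per 24 (nat m)"
    using kfib_period_24_iff[OF assms(2), of "nat m"] P_pos by (simp add: m nat_mult_distrib)
  ultimately have per: "?per m (nat m)" using per_split by blast
  \<comment> \<open>Minimality: a period \<open>t\<close> modulo \<open>m\<close> is a multiple of
    24, and \<open>P\<close> divides \<open>kfib K t\<close>, hence \<open>t\<close>.\<close>
  have "nat m \<le> t" if "0 < t" "?per m t" for t
  proof -
    have "24 dvd t"
      using that per_split kfib_period_24_iff[OF assms(2), of t] by blast
    then have "24 dvd int t" by presburger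
    moreover have "P dvd int t"
      using that per_split[of t] kfib_period_iff[of K t P] P_dvd by (simp add: cong_0_iff)
    ultimately have "m dvd int t" unfolding m using cop by (simp add: divides_mult)
    then show ?thesis using that zdvd_imp_le[of m "int t"] by simp
  qed
  then have "kperiod K m = nat m"
    unfolding kperiod_def using per P_pos by (intro Least_equality) (auto simp: m)
  then show ?thesis using P_pos by (simp add: m)
qed

end
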